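(* Let $v>0$ and let $(X_t)_{t\ge1}$ be random vectors in $\mathbb{R}^d$ with $\mathbb{E}[X_t\mid\mathcal{F}_{t-1}]=\mu$ and $\mathbb{E}[\|X_t\|^2\mid\mathcal{F}_{t-1}]\le v^2$ for all $t\ge1$. Let $(\lambda_t)_{t\ge1}$ be a sequence of positive scalars and fix $\beta>0$. Then, for any $\alpha\in(0,1)$, with probability at least $1-\alpha$, for all $t\geq1$ simultaneously, $$\left\|\frac{\sum_{i\leq t}\lambda_i\,\mathrm{th}_i(X_i)}{\sum_{i\leq t}\lambda_i}-\mu\right\|\leq\frac{v^2\left(2e^{\frac2\beta+2}+1\right)\sum_{i\leq t}\lambda_i^2+\beta/2+\log(1/\alpha)}{\sum_{i\leq t}\lambda_i}.$$
   Context: $\mathcal{F}_t=\sigma(X_1,\dots,X_t)$ ($\mathcal{F}_0$ trivial). $\|\cdot\|$ is the Euclidean norm. The threshold function is $\mathrm{th}_t(x):=\dfrac{(\lambda_t\|x\|)\wedge1}{\lambda_t\|x\|}\,x$ for $x\in\mathbb{R}^d$ (with $\mathrm{th}_t(0)=0$), where $a\wedge b=\min\{a,b\}$. *)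

theory Defs
  imports "HOL-Probability.Probability"
begin

(* sigma(X 1, ..., X t); for t = 0 the generating family is empty, which gives the
   trivial sigma-algebra on space M.  X 0 is never used. *)
definition nat_filtration :: "'w measure \<Rightarrow> (nat \<Rightarrow> 'w \<Rightarrow> 'a::topological_space) \<Rightarrow> nat \<Rightarrow> 'w measure"
  where "nat_filtration M X t =
    sigma (space M) (\<Union>i\<in>{1..t}. {X i -` B \<inter> space M | B. B \<in> sets borel})"

(* The library has conditional expectations of real-valued functions only; that of a random
   vector is taken coordinatewise.  As for real_cond_exp, the value is meaningful only for
   integrable arguments. *)
definition vec_cond_exp :: "'w measure \<Rightarrow> 'w measure \<Rightarrow> ('w \<Rightarrow> 'a::euclidean_space) \<Rightarrow> 'w \<Rightarrow> 'a"
  where "vec_cond_exp M F Y \<omega> =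
    (\<Sum>b\<in>Basis. real_cond_exp M F (\<lambda>\<omega>. Y \<omega> \<bullet> b) \<omega> *\<^sub>R b)"

(* At x = 0 the scalar factor is 0 / 0 = 0, so th l 0 = 0. *)
definition th :: "real \<Rightarrow> 'a::euclidean_space \<Rightarrow> 'a"
  where "th l x = (min (l * norm x) 1 / (l * norm x)) *\<^sub>R x"

end

theory Submission
  imports Defs
begin

text \<open>
  Let \<open>\<epsilon> = \<beta> / 2\<close>, \<open>\<phi> x = sqrt (\<parallel>x\<parallel>\<^sup>2 + \<epsilon>\<^sup>2) - \<epsilon>\<close> and let \<open>S t\<close> be the sum of the increments
  \<open>\<lambda>\<^sub>i (th\<^sub>i X\<^sub>i - \<mu>)\<close>. Then \<open>\<phi>\<close> is 1-Lipschitz, \<open>\<phi> 0 = 0\<close> and \<open>\<parallel>x\<parallel> \<le> \<phi> x + \<beta> / 2\<close>, so it suffices that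
  \<open>exp (\<phi> (S t) - K * \<Sum> \<lambda>\<^sub>i\<^sup>2)\<close> with \<open>K = v\<^sup>2 (2 exp (2 / \<beta> + 2) + 1)\<close> is a supermartingale, and Ville's
  inequality applies. An increment with \<open>\<lambda>\<^sub>i v \<ge> 1\<close> has norm at most \<open>1 + \<lambda>\<^sub>i v \<le> K \<lambda>\<^sub>i\<^sup>2\<close>.
  Otherwise its norm is at most 2, and a second order expansion of \<open>exp \<circ> \<phi>\<close> leaves the thresholding bias,
  at most \<open>\<lambda>\<^sub>i\<^sup>2 v\<^sup>2\<close>, and a quadratic term, at most \<open>2 exp (2 / \<beta> + 2) \<lambda>\<^sub>i\<^sup>2 v\<^sup>2\<close>.
\<close>

section \<open>A smooth surrogate for the norm\<close>

text \<open>Up to the factor \<open>\<epsilon>\<close>, the pseudo-Huber function of the norm. The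
  square root is the Euclidean length of the pair formed by \<open>x\<close> and
  \<open>\<epsilon>\<close>, which is where both the Lipschitz bound and the curvature bound come
  from.\<close>

definition smooth_norm :: "real \<Rightarrow> 'a::real_inner \<Rightarrow> real"
  where "smooth_norm \<epsilon> x = sqrt ((norm x)\<^sup>2 + \<epsilon>\<^sup>2) - \<epsilon>"

definition smooth_norm_grad :: "real \<Rightarrow> 'a::real_inner \<Rightarrow> 'a"
  where "smooth_norm_grad \<epsilon> x = x /\<^sub>R sqrt ((norm x)\<^sup>2 + \<epsilon>\<^sup>2)"

lemma borel_measurable_smooth_norm [measurable]:
  "smooth_norm \<epsilon> \<in> borel_measurable (borel :: 'a::euclidean_space measure)"
  unfolding smooth_norm_def[abs_def] by measurable

lemma borel_measurable_smooth_norm_grad [measurable]: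
  "smooth_norm_grad \<epsilon> \<in> borel_measurable (borel :: 'a::euclidean_space measure)"
  unfolding smooth_norm_grad_def[abs_def] by measurable

lemma smooth_norm_zero: "\<epsilon> > 0 \<Longrightarrow> smooth_norm \<epsilon> 0 = 0"
  by (simp add: smooth_norm_def)

lemma norm_le_smooth_norm: "norm x \<le> smooth_norm \<epsilon> x + \<epsilon>"
  by (simp add: smooth_norm_def real_le_rsqrt)

lemma smooth_norm_le_norm: "\<epsilon> > 0 \<Longrightarrow> smooth_norm \<epsilon> x \<le> norm x"
  unfolding smooth_norm_def
  using sqrt_sum_squares_le_sum[of "norm x" \<epsilon>] by simp

lemma norm_smooth_norm_grad_le: "norm (smooth_norm_grad \<epsilon> x) \<le> 1"
proof -
  have "norm x \<le> sqrt ((norm x)\<^sup>2 + \<epsilon>\<^sup>2)" by (simp add: real_le_rsqrt)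
  thus ?thesis
    by (simp add: smooth_norm_grad_def divide_simps mult.commute)
       (smt (verit) norm_ge_zero real_sqrt_ge_zero zero_le_power2)
qed

text \<open>Triangle inequality in the plane for the vectors with coordinates \<open>norm x\<close>,
  \<open>\<epsilon>\<close> and \<open>norm d\<close>, \<open>0\<close>; hence the spelling
  \<open>\<epsilon> + 0\<close> in the proof.\<close>

lemma smooth_norm_diff_le_norm: "smooth_norm \<epsilon> (x + d) - smooth_norm \<epsilon> x \<le> norm d"
proof -
  have "sqrt ((norm (x + d))\<^sup>2 + \<epsilon>\<^sup>2) \<le> sqrt ((norm x + norm d)\<^sup>2 + (\<epsilon> + 0)\<^sup>2)"
    by (simp add: norm_triangle_ineq power_mono)
  also have "\<dots> \<le> sqrt ((norm x)\<^sup>2 + \<epsilon>\<^sup>2) + sqrt ((norm d)\<^sup>2 + 0\<^sup>2)"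
    by (rule real_sqrt_sum_squares_triangle_ineq)
  finally show ?thesis by (simp add: smooth_norm_def)
qed

lemma abs_smooth_norm_diff_le_norm: "\<bar>smooth_norm \<epsilon> (x + d) - smooth_norm \<epsilon> x\<bar> \<le> norm d"
  using smooth_norm_diff_le_norm[of \<epsilon> x d] smooth_norm_diff_le_norm[of \<epsilon> "x + d" "- d"] by simp

text \<open>No calculus is used. If \<open>R\<close> and \<open>q\<close> are the square roots at
  \<open>x\<close> and \<open>x + d\<close>, then
  \<open>2 * R * q \<le> R\<^sup>2 + q\<^sup>2\<close> bounds \<open>2 * R * (q - R)\<close> by
  \<open>q\<^sup>2 - R\<^sup>2\<close>, which is an explicit polynomial in \<open>d\<close>.
  Dividing by \<open>2 * R\<close> and using \<open>R \<ge> \<epsilon>\<close> in the quadratic term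
  gives the claim.\<close>

lemma smooth_norm_diff_le_quadratic:
  assumes "\<epsilon> > 0"
  shows "smooth_norm \<epsilon> (x + d) - smooth_norm \<epsilon> x
           \<le> smooth_norm_grad \<epsilon> x \<bullet> d + (norm d)\<^sup>2 / (2 * \<epsilon>)"
proof -
  define R where "R = sqrt ((norm x)\<^sup>2 + \<epsilon>\<^sup>2)"
  have R: "R \<ge> \<epsilon>" "R > 0" using assms by (auto simp: R_def real_le_rsqrt add_nonneg_pos)
  have R2: "R\<^sup>2 = (norm x)\<^sup>2 + \<epsilon>\<^sup>2" by (simp add: R_def)
  define q where "q = sqrt ((norm (x + d))\<^sup>2 + \<epsilon>\<^sup>2)"
  have "q\<^sup>2 = (norm (x + d))\<^sup>2 + \<epsilon>\<^sup>2" by (simp add: q_def)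
  also have "\<dots> = R\<^sup>2 + 2 * (x \<bullet> d) + (norm d)\<^sup>2"
    by (simp add: R2 power2_norm_eq_inner inner_add_left inner_add_right inner_commute)
  finally have q2: "q\<^sup>2 = R\<^sup>2 + 2 * (x \<bullet> d) + (norm d)\<^sup>2" .
  have "2 * R * (q - R) = 2 * R * q - 2 * R\<^sup>2" by (simp add: algebra_simps power2_eq_square)
  also have "\<dots> \<le> 2 * (x \<bullet> d) + (norm d)\<^sup>2"
    using sum_squares_bound[of R q] q2 by linarith
  finally have "2 * R * (q - R) \<le> 2 * (x \<bullet> d) + (norm d)\<^sup>2" .
  hence "q - R \<le> (2 * (x \<bullet> d) + (norm d)\<^sup>2) / (2 * R)"
    using R by (simp add: pos_le_divide_eq mult.commute)
  also have "\<dots> = (x \<bullet> d) / R + (norm d)\<^sup>2 / (2 * R)" using R by (simp add: field_simps)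
  also have "\<dots> \<le> (x \<bullet> d) / R + (norm d)\<^sup>2 / (2 * \<epsilon>)"
    using R assms by (intro add_left_mono divide_left_mono) auto
  finally have "q - R \<le> (x \<bullet> d) / R + (norm d)\<^sup>2 / (2 * \<epsilon>)" .
  moreover have "smooth_norm_grad \<epsilon> x \<bullet> d = (x \<bullet> d) / R"
    unfolding smooth_norm_grad_def R_def[symmetric] by (simp add: divide_inverse)
  moreover have "smooth_norm \<epsilon> (x + d) - smooth_norm \<epsilon> x = q - R"
    unfolding smooth_norm_def q_def R_def by simp
  ultimately show ?thesis by simp
qed

text \<open>Taylor's formula with Lagrange remainder. The radius 2 matches the bound on the norm of
  an increment when \<open>l * v < 1\<close>.\<close>

lemma exp_le_quadratic:
  assumes "\<bar>u\<bar> \<le> 2"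
  shows "exp u \<le> 1 + u + exp 2 / 2 * (u::real)\<^sup>2"
proof -
  obtain s where s: "\<bar>s\<bar> \<le> \<bar>u\<bar>" "exp u = (\<Sum>m<2. (u ^ m) / fact m) + (exp s / fact 2) * u ^ 2"
    using Maclaurin_exp_le[of u 2] by blast
  have "exp s / 2 * u\<^sup>2 \<le> exp 2 / 2 * u\<^sup>2"
    using s(1) assms by (intro mult_right_mono) auto
  thus ?thesis using s(2) by (simp add: numeral_2_eq_2)
qed

text \<open>In the expansion of \<open>exp u\<close>, the linear term is bounded through the
  curvature of \<open>smooth_norm\<close> and the square through its Lipschitz constant 1. The two
  second order contributions have coefficients \<open>1 / \<epsilon>\<close> and
  \<open>exp 2\<close>, up to the common factor 1/2.\<close>

lemma exp_smooth_norm_diff_le: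
  assumes "\<epsilon> > 0" "norm d \<le> 2"
  shows "exp (smooth_norm \<epsilon> (x + d) - smooth_norm \<epsilon> x)
           \<le> 1 + smooth_norm_grad \<epsilon> x \<bullet> d + exp (1 / \<epsilon> + 2) / 2 * (norm d)\<^sup>2"
proof -
  define u where "u = smooth_norm \<epsilon> (x + d) - smooth_norm \<epsilon> x"
  have u: "\<bar>u\<bar> \<le> norm d" unfolding u_def by (rule abs_smooth_norm_diff_le_norm)
  have "exp u \<le> 1 + u + exp 2 / 2 * u\<^sup>2" using u assms by (intro exp_le_quadratic) auto
  also have "\<dots> \<le> 1 + (smooth_norm_grad \<epsilon> x \<bullet> d + (norm d)\<^sup>2 / (2 * \<epsilon>)) + exp 2 / 2 * (norm d)\<^sup>2"
    using u unfolding u_def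
    by (intro add_mono smooth_norm_diff_le_quadratic assms mult_left_mono order_refl)
       (auto simp: abs_le_square_iff[symmetric])
  also have "\<dots> = 1 + smooth_norm_grad \<epsilon> x \<bullet> d + (1 / \<epsilon> + exp 2) / 2 * (norm d)\<^sup>2"
    by (simp add: field_simps)
  also have "\<dots> \<le> 1 + smooth_norm_grad \<epsilon> x \<bullet> d + exp (1 / \<epsilon> + 2) / 2 * (norm d)\<^sup>2"
  proof -
    \<comment> \<open>Both coefficients are merged into a single exponential by
      \<open>1 + 1 / \<epsilon> \<le> exp (1 / \<epsilon>)\<close>; this produces the constant
      \<open>exp (2 / \<beta> + 2)\<close> of the theorem.\<close>
    have "1 / \<epsilon> + exp 2 \<le> (1 / \<epsilon>) * exp 2 + exp (2::real)"
      using assms by (simp add: field_simps)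
    also have "\<dots> = (1 + 1 / \<epsilon>) * exp 2" by (simp add: algebra_simps)
    also have "\<dots> \<le> exp (1 / \<epsilon>) * exp 2" by (intro mult_right_mono exp_ge_add_one_self) auto
    finally show ?thesis by (intro add_left_mono mult_right_mono divide_right_mono) (auto simp: exp_add)
  qed
  finally show ?thesis unfolding u_def .
qed

section \<open>The threshold map\<close>

lemma borel_measurable_th [measurable]:
  "th l \<in> borel_measurable (borel :: 'a::euclidean_space measure)"
  unfolding th_def[abs_def] by measurable

lemma th_inside: "l * norm x \<le> 1 \<Longrightarrow> l > 0 \<Longrightarrow> th l x = x"
  by (cases "x = 0") (auto simp: th_def min_def)

lemma th_outside: "l * norm x > 1 \<Longrightarrow> th l x = (1 / (l * norm x)) *\<^sub>R x"
  by (simp add: th_def)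

text \<open>For positive \<open>l\<close>, \<open>th l\<close> is the radial projection onto the
  closed ball of radius \<open>1 / l\<close>.\<close>

lemma norm_th:
  assumes "l > 0"
  shows "norm (th l x) = min (norm x) (1 / l)"
proof (cases "l * norm x \<le> 1")
  case True
  thus ?thesis using assms by (simp add: th_inside min_def field_simps)
next
  case False
  hence "x \<noteq> 0" by auto
  with False show ?thesis using assms by (simp add: th_outside min_def field_simps)
qed

text \<open>Only points with \<open>l * norm x > 1\<close> are moved, by at most
  \<open>norm x\<close>, and there an extra factor \<open>l * norm x\<close> only enlarges the
  bound. The quadratic form lets the second moment control the thresholding bias.\<close>

lemma norm_th_diff_le:
  assumes "l > 0"
  shows "norm (th l x - x) \<le> l * (norm x)\<^sup>2"
proof (cases "l * norm x \<le> 1")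
  case True
  thus ?thesis using assms by (simp add: th_inside)
next
  case False
  hence "th l x - x = (1 / (l * norm x) - 1) *\<^sub>R x"
    by (simp add: th_outside scaleR_diff_left)
  moreover have "1 / (l * norm x) < 1" "0 \<le> 1 / (l * norm x)" using False by simp_all
  ultimately have "norm (th l x - x) = (1 - 1 / (l * norm x)) * norm x" by simp
  also have "\<dots> \<le> (l * norm x) * norm x"
    using False \<open>0 \<le> 1 / (l * norm x)\<close> by (intro mult_right_mono norm_ge_zero) linarith
  finally show ?thesis by (simp add: power2_eq_square)
qed

section \<open>Conditional moments\<close>

text \<open>One time step: \<open>F\<close> is the past and \<open>X\<close> the next observation.
  The second moment is conditioned as a nonnegative function, so integrability of \<open>X\<close>
  can be derived instead of assumed.\<close>

locale conditional_moments = prob_space M + finite_measure_subalgebra M F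
  for M F :: "'w measure" +
  fixes X :: "'w \<Rightarrow> 'a::euclidean_space" and \<mu> :: 'a and v :: real
  assumes X [measurable]: "X \<in> borel_measurable M"
    and cond_mean: "AE \<omega> in M. vec_cond_exp M F X \<omega> = \<mu>"
    and cond_second_moment:
      "AE \<omega> in M. nn_cond_exp M F (\<lambda>\<omega>. ennreal ((norm (X \<omega>))\<^sup>2)) \<omega> \<le> ennreal (v\<^sup>2)"
    and v_pos: "v > 0"
begin

text \<open>The conditional bound is tested against a nonnegative weight \<open>W\<close> known from
  the past; the defining property of the conditional expectation moves the conditioning under the
  integral.\<close>

lemma nn_integral_weighted_second_moment:
  assumes "W \<in> borel_measurable F" "\<And>\<omega>. 0 \<le> W \<omega>"
  shows "(\<integral>\<^sup>+\<omega>. ennreal (W \<omega> * (norm (X \<omega>))\<^sup>2) \<partial>M) \<le> (\<integral>\<^sup>+\<omega>. ennreal (v\<^sup>2 * W \<omega>) \<partial>M)"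
proof -
  have "(\<integral>\<^sup>+\<omega>. ennreal (W \<omega> * (norm (X \<omega>))\<^sup>2) \<partial>M)
      = (\<integral>\<^sup>+\<omega>. ennreal (W \<omega>) * ennreal ((norm (X \<omega>))\<^sup>2) \<partial>M)"
    using assms by (simp add: ennreal_mult)
  also have "\<dots> = (\<integral>\<^sup>+\<omega>. ennreal (W \<omega>) * nn_cond_exp M F (\<lambda>\<omega>. ennreal ((norm (X \<omega>))\<^sup>2)) \<omega> \<partial>M)"
    using assms by (intro nn_cond_exp_intg[symmetric]) auto
  also have "\<dots> \<le> (\<integral>\<^sup>+\<omega>. ennreal (W \<omega>) * ennreal (v\<^sup>2) \<partial>M)"
    by (intro nn_integral_mono_AE eventually_mono[OF cond_second_moment] mult_left_mono) auto
  also have "\<dots> = (\<integral>\<^sup>+\<omega>. ennreal (v\<^sup>2 * W \<omega>) \<partial>M)"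
    using assms by (simp add: ennreal_mult mult.commute)
  finally show ?thesis .
qed

lemma integrable_norm_square: "integrable M (\<lambda>\<omega>. (norm (X \<omega>))\<^sup>2)"
proof (rule integrableI_nonneg)
  have "(\<integral>\<^sup>+\<omega>. ennreal (1 * (norm (X \<omega>))\<^sup>2) \<partial>M) \<le> (\<integral>\<^sup>+\<omega>. ennreal (v\<^sup>2 * 1) \<partial>M)"
    by (rule nn_integral_weighted_second_moment) auto
  also have "\<dots> < \<infinity>" by (simp add: emeasure_space_1)
  finally show "(\<integral>\<^sup>+\<omega>. ennreal ((norm (X \<omega>))\<^sup>2) \<partial>M) < \<infinity>" by simp
qed auto

lemma integrable_X: "integrable M X"
proof (rule Bochner_Integration.integrable_bound)
  show "integrable M (\<lambda>\<omega>. 1 + (norm (X \<omega>))\<^sup>2)" using integrable_norm_square by simp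
  have "norm x \<le> 1 + (norm x)\<^sup>2" for x :: 'a
    using sum_squares_bound[of "norm x" 1] norm_ge_zero[of x] unfolding power_one by linarith
  thus "AE \<omega> in M. norm (X \<omega>) \<le> norm (1 + (norm (X \<omega>))\<^sup>2)"
    by (intro AE_I2) (simp add: order_trans[OF _ abs_ge_self])
qed auto

lemma integrable_bounded_mult:
  fixes f :: "'w \<Rightarrow> real"
  assumes "integrable M f" "W \<in> borel_measurable M" "\<And>\<omega>. \<bar>W \<omega>\<bar> \<le> B"
  shows "integrable M (\<lambda>\<omega>. W \<omega> * f \<omega>)"
proof (rule Bochner_Integration.integrable_bound)
  show "integrable M (\<lambda>\<omega>. B * f \<omega>)" using assms by simp
  show "(\<lambda>\<omega>. W \<omega> * f \<omega>) \<in> borel_measurable M" using assms by measurable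
  have "\<bar>W \<omega>\<bar> \<le> \<bar>B\<bar>" for \<omega> using assms(3)[of \<omega>] by linarith
  thus "AE \<omega> in M. norm (W \<omega> * f \<omega>) \<le> norm (B * f \<omega>)"
    by (intro AE_I2) (simp add: abs_mult mult_right_mono)
qed

lemma weighted_second_moment:
  assumes W: "W \<in> borel_measurable F" and "\<And>\<omega>. 0 \<le> W \<omega>" "\<And>\<omega>. W \<omega> \<le> B"
  shows "(\<integral>\<omega>. W \<omega> * (norm (X \<omega>))\<^sup>2 \<partial>M) \<le> v\<^sup>2 * (\<integral>\<omega>. W \<omega> \<partial>M)"
proof -
  have [measurable]: "W \<in> borel_measurable M" by (rule measurable_from_subalg[OF subalg W])
  have B: "\<bar>W \<omega>\<bar> \<le> B" for \<omega> using assms(2,3)[of \<omega>] by simp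
  have i: "integrable M W" by (rule integrable_const_bound[of _ B]) (auto simp: B)
  have j: "integrable M (\<lambda>\<omega>. W \<omega> * (norm (X \<omega>))\<^sup>2)"
    by (rule integrable_bounded_mult[OF integrable_norm_square _ B]) simp
  have "ennreal (\<integral>\<omega>. W \<omega> * (norm (X \<omega>))\<^sup>2 \<partial>M) = (\<integral>\<^sup>+\<omega>. ennreal (W \<omega> * (norm (X \<omega>))\<^sup>2) \<partial>M)"
    using j assms by (intro nn_integral_eq_integral[symmetric]) auto
  also have "\<dots> \<le> (\<integral>\<^sup>+\<omega>. ennreal (v\<^sup>2 * W \<omega>) \<partial>M)"
    by (intro nn_integral_weighted_second_moment assms)
  also have "\<dots> = ennreal (\<integral>\<omega>. v\<^sup>2 * W \<omega> \<partial>M)"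
    using i assms by (intro nn_integral_eq_integral) auto
  finally show ?thesis using assms by (subst (asm) ennreal_le_iff) (auto intro!: Bochner_Integration.integral_nonneg)
qed

text \<open>The centred observation is orthogonal to every bounded vector field known from the past.
  This later removes the first order term of the expansion. The argument runs coordinatewise, like
  the definition of \<open>vec_cond_exp\<close>.\<close>

lemma weighted_mean:
  fixes G :: "'w \<Rightarrow> 'a"
  assumes G: "G \<in> borel_measurable F" and B: "\<And>\<omega>. norm (G \<omega>) \<le> B"
  shows "(\<integral>\<omega>. G \<omega> \<bullet> (X \<omega> - \<mu>) \<partial>M) = 0" and "integrable M (\<lambda>\<omega>. G \<omega> \<bullet> (X \<omega> - \<mu>))"
proof -
  note [measurable] = G measurable_from_subalg[OF subalg G]
  have Bb: "\<bar>G \<omega> \<bullet> b\<bar> \<le> B" if "b \<in> Basis" for b \<omega>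
    using Basis_le_norm[OF that, of "G \<omega>"] B[of \<omega>] by simp
  have Xb: "integrable M (\<lambda>\<omega>. X \<omega> \<bullet> b)" for b using integrable_X by simp
  have i1: "integrable M (\<lambda>\<omega>. (G \<omega> \<bullet> b) * (X \<omega> \<bullet> b))" if "b \<in> Basis" for b
    by (rule integrable_bounded_mult[OF Xb _ Bb[OF that]]) simp
  have i2: "integrable M (\<lambda>\<omega>. (G \<omega> \<bullet> b) * (\<mu> \<bullet> b))" if "b \<in> Basis" for b
    by (rule integrable_bounded_mult[OF _ _ Bb[OF that]]) simp_all
  have e: "(\<integral>\<omega>. (G \<omega> \<bullet> b) * (X \<omega> \<bullet> b) \<partial>M) = (\<integral>\<omega>. (G \<omega> \<bullet> b) * (\<mu> \<bullet> b) \<partial>M)"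
    if b: "b \<in> Basis" for b
  proof -
    have "(\<integral>\<omega>. (G \<omega> \<bullet> b) * (X \<omega> \<bullet> b) \<partial>M)
        = (\<integral>\<omega>. (G \<omega> \<bullet> b) * real_cond_exp M F (\<lambda>\<omega>. X \<omega> \<bullet> b) \<omega> \<partial>M)"
      by (rule real_cond_exp_intg(2)[symmetric]) (use i1[OF b] in auto)
    also have "\<dots> = (\<integral>\<omega>. (G \<omega> \<bullet> b) * (\<mu> \<bullet> b) \<partial>M)"
    proof (intro integral_cong_AE)
      show "AE \<omega> in M. (G \<omega> \<bullet> b) * real_cond_exp M F (\<lambda>\<omega>. X \<omega> \<bullet> b) \<omega> = (G \<omega> \<bullet> b) * (\<mu> \<bullet> b)"
        using cond_mean
      proof eventually_elim
        case (elim \<omega>)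
        have "vec_cond_exp M F X \<omega> \<bullet> b = real_cond_exp M F (\<lambda>\<omega>. X \<omega> \<bullet> b) \<omega>"
          unfolding vec_cond_exp_def using b by simp
        thus ?case by (simp add: elim)
      qed
    qed auto
    finally show ?thesis .
  qed
  have eq: "G \<omega> \<bullet> (X \<omega> - \<mu>) = (\<Sum>b\<in>Basis. (G \<omega> \<bullet> b) * (X \<omega> \<bullet> b) - (G \<omega> \<bullet> b) * (\<mu> \<bullet> b))" for \<omega>
    by (subst euclidean_inner) (simp add: inner_diff_left algebra_simps)
  show "integrable M (\<lambda>\<omega>. G \<omega> \<bullet> (X \<omega> - \<mu>))"
    unfolding eq using i1 i2 by (intro Bochner_Integration.integrable_sum) auto
  show "(\<integral>\<omega>. G \<omega> \<bullet> (X \<omega> - \<mu>) \<partial>M) = 0"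
    unfolding eq using i1 i2 e by (subst Bochner_Integration.integral_sum) auto
qed

text \<open>Testing with the constant field \<open>\<mu>\<close> shows that the squared norm of
  \<open>\<mu>\<close> is the mean of \<open>\<mu> \<bullet> X \<omega>\<close>. By Cauchy-Schwarz
  and the arithmetic-geometric mean inequality this is at most half of
  \<open>(norm \<mu>)\<^sup>2 + v\<^sup>2\<close>, and half of the left side is absorbed.\<close>

lemma norm_mean_le: "norm \<mu> \<le> v"
proof -
  have i: "integrable M (\<lambda>\<omega>. \<mu> \<bullet> X \<omega>)" using integrable_X by simp
  have "(\<integral>\<omega>. \<mu> \<bullet> (X \<omega> - \<mu>) \<partial>M) = 0" by (rule weighted_mean[of "\<lambda>_. \<mu>" "norm \<mu>"]) auto
  hence "(norm \<mu>)\<^sup>2 = (\<integral>\<omega>. \<mu> \<bullet> X \<omega> \<partial>M)"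
    using i by (simp add: inner_diff_right prob_space power2_norm_eq_inner)
  also have "\<dots> \<le> (\<integral>\<omega>. ((norm \<mu>)\<^sup>2 + (norm (X \<omega>))\<^sup>2) / 2 \<partial>M)"
  proof (intro integral_mono i)
    fix \<omega>
    show "\<mu> \<bullet> X \<omega> \<le> ((norm \<mu>)\<^sup>2 + (norm (X \<omega>))\<^sup>2) / 2"
      using norm_cauchy_schwarz[of \<mu> "X \<omega>"] sum_squares_bound[of "norm \<mu>" "norm (X \<omega>)"] by simp
  qed (use integrable_norm_square in simp)
  also have "\<dots> = ((norm \<mu>)\<^sup>2 + (\<integral>\<omega>. (norm (X \<omega>))\<^sup>2 \<partial>M)) / 2"
    using integrable_norm_square by (simp add: prob_space)
  also have "(\<integral>\<omega>. (norm (X \<omega>))\<^sup>2 \<partial>M) \<le> v\<^sup>2"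
    using weighted_second_moment[of "\<lambda>_. 1" 1] by (simp add: prob_space)
  finally have "(norm \<mu>)\<^sup>2 \<le> v\<^sup>2" by simp
  thus ?thesis using v_pos by (rule power2_le_imp_le[OF _ less_imp_le])
qed

text \<open>The one-step supermartingale estimate, tested against bounded past weights
  \<open>W\<close>, so that no conditional expectation of the exponential has to be formed. In the
  application \<open>W\<close> is the current value of the process restricted to a past
  event.\<close>

lemma weighted_exp_smooth_norm_step:
  assumes W: "W \<in> borel_measurable F" "\<And>\<omega>. 0 \<le> W \<omega>" "\<And>\<omega>. W \<omega> \<le> B"
    and S: "S \<in> borel_measurable F" and l: "l > 0" and \<epsilon>: "\<epsilon> > 0"
  shows "(\<integral>\<omega>. W \<omega> * exp (smooth_norm \<epsilon> (S \<omega> + l *\<^sub>R (th l (X \<omega>) - \<mu>)) - smooth_norm \<epsilon> (S \<omega>)) \<partial>M)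
           \<le> exp (v\<^sup>2 * (2 * exp (1 / \<epsilon> + 2) + 1) * l\<^sup>2) * (\<integral>\<omega>. W \<omega> \<partial>M)"
proof -
  note [measurable] = W(1) S measurable_from_subalg[OF subalg W(1)] measurable_from_subalg[OF subalg S]
  define C where "C = exp (1 / \<epsilon> + 2)"
  have C: "C > 0" by (simp add: C_def)
  define d where "d \<omega> = l *\<^sub>R (th l (X \<omega>) - \<mu>)" for \<omega>
  define E where "E \<omega> = exp (smooth_norm \<epsilon> (S \<omega> + d \<omega>) - smooth_norm \<epsilon> (S \<omega>))" for \<omega>
  define K where "K = v\<^sup>2 * (2 * C + 1) * l\<^sup>2"
  have [measurable]: "d \<in> borel_measurable M" "E \<in> borel_measurable M"
    unfolding d_def[abs_def] E_def[abs_def] by measurable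
  have WB: "\<bar>W \<omega>\<bar> \<le> B" for \<omega> using W(2,3)[of \<omega>] by simp
  have B0: "B \<ge> 0" using WB[of undefined] by linarith
  have iW: "integrable M W" by (rule integrable_const_bound[of _ B]) (auto simp: WB)
  have d_le: "norm (d \<omega>) \<le> 1 + l * v" for \<omega>
  proof -
    have "norm (d \<omega>) = l * norm (th l (X \<omega>) - \<mu>)" using l by (simp add: d_def)
    also have "\<dots> \<le> l * (1 / l + v)"
      using norm_triangle_ineq4[of "th l (X \<omega>)" \<mu>] norm_th[OF l, of "X \<omega>"] norm_mean_le l
      by (intro mult_left_mono) auto
    also have "\<dots> = 1 + l * v" using l by (simp add: field_simps)
    finally show ?thesis .
  qed
  have E_le: "E \<omega> \<le> exp (1 + l * v)" for \<omega>
    using smooth_norm_diff_le_norm[of \<epsilon> "S \<omega>" "d \<omega>"] d_le[of \<omega>] by (simp add: E_def)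
  have E0: "0 \<le> E \<omega>" for \<omega> by (simp add: E_def)
  have iWE: "integrable M (\<lambda>\<omega>. W \<omega> * E \<omega>)"
    using E_le E0 by (intro integrable_bounded_mult[OF _ _ WB] integrable_const_bound[of _ "exp (1 + l * v)"]) auto
  have "(\<integral>\<omega>. W \<omega> * E \<omega> \<partial>M) \<le> exp K * (\<integral>\<omega>. W \<omega> \<partial>M)"
  proof (cases "l * v \<ge> 1")
    case True
    \<comment> \<open>The increment is bounded by the compensator itself, so no cancellation is needed.\<close>
    have "1 \<le> C" unfolding C_def using \<epsilon> by simp
    moreover have "l * v \<le> (l * v)\<^sup>2" "1 \<le> (l * v)\<^sup>2"
      using True mult_right_mono[OF True, of "l * v"] by (auto simp: power2_eq_square)
    ultimately have "1 + l * v \<le> (2 * C + 1) * (l * v)\<^sup>2"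
      using mult_right_mono[of 2 "2 * C + 1" "(l * v)\<^sup>2"] by simp
    hence "exp (1 + l * v) \<le> exp K" by (simp add: K_def power_mult_distrib ac_simps)
    hence "E \<omega> \<le> exp K" for \<omega> using E_le[of \<omega>] by (rule order_trans[rotated])
    hence "(\<integral>\<omega>. W \<omega> * E \<omega> \<partial>M) \<le> (\<integral>\<omega>. W \<omega> * exp K \<partial>M)"
      using iW iWE W(2) by (intro integral_mono) (auto intro: mult_left_mono)
    thus ?thesis by (simp add: mult.commute)
  next
    case False
    define g where "g \<omega> = smooth_norm_grad \<epsilon> (S \<omega>)" for \<omega>
    have [measurable]: "g \<in> borel_measurable F" unfolding g_def[abs_def] by measurable
    have g1: "norm (g \<omega>) \<le> 1" for \<omega> unfolding g_def by (rule norm_smooth_norm_grad_le)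
    \<comment> \<open>The gradient at the past sum is known from the past; multiplied by
      \<open>W\<close> it is an admissible field for \<open>weighted_mean\<close>.\<close>
    let ?G = "\<lambda>\<omega>. W \<omega> *\<^sub>R g \<omega>"
    have GB: "norm (?G \<omega>) \<le> B" for \<omega>
      using mult_mono[OF WB[of \<omega>] g1[of \<omega>]] B0 by simp
    have GF: "?G \<in> borel_measurable F" by measurable
    let ?A = "\<lambda>\<omega>. ?G \<omega> \<bullet> (X \<omega> - \<mu>)" and ?Q = "\<lambda>\<omega>. W \<omega> * (norm (X \<omega>))\<^sup>2"
    have iA: "integrable M ?A" and A0: "(\<integral>\<omega>. ?A \<omega> \<partial>M) = 0"
      using weighted_mean[of ?G B, OF GF GB] by simp_all
    have iQ: "integrable M ?Q"
      by (rule integrable_bounded_mult[OF integrable_norm_square _ WB]) simp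
    \<comment> \<open>The linear term is split by writing \<open>th l (X \<omega>) - \<mu>\<close>
      as \<open>X \<omega> - \<mu>\<close> plus the thresholding error. The quadratic term uses
      \<open>norm (th l (X \<omega>)) \<le> norm (X \<omega>)\<close>,
      \<open>norm \<mu> \<le> v\<close> and the estimate of the square of a sum by twice the sum of
      squares.\<close>
    have pw: "E \<omega> \<le> 1 + l * (g \<omega> \<bullet> (X \<omega> - \<mu>)) + l\<^sup>2 * (norm (X \<omega>))\<^sup>2
                 + C * l\<^sup>2 * ((norm (X \<omega>))\<^sup>2 + v\<^sup>2)" for \<omega>
    proof -
      have d2: "norm (d \<omega>) \<le> 2" using d_le[of \<omega>] False by simp
      have "g \<omega> \<bullet> d \<omega> = l * (g \<omega> \<bullet> (X \<omega> - \<mu>)) + l * (g \<omega> \<bullet> (th l (X \<omega>) - X \<omega>))"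
        by (simp add: d_def inner_diff_right algebra_simps)
      also have "g \<omega> \<bullet> (th l (X \<omega>) - X \<omega>) \<le> 1 * (l * (norm (X \<omega>))\<^sup>2)"
        using g1 norm_th_diff_le[OF l] l
        by (intro order_trans[OF norm_cauchy_schwarz] mult_mono) auto
      finally have gd: "g \<omega> \<bullet> d \<omega> \<le> l * (g \<omega> \<bullet> (X \<omega> - \<mu>)) + l\<^sup>2 * (norm (X \<omega>))\<^sup>2"
        using l by (simp add: power2_eq_square)
      have "(norm (d \<omega>))\<^sup>2 = l\<^sup>2 * (norm (th l (X \<omega>) - \<mu>))\<^sup>2" by (simp add: d_def power_mult_distrib)
      also have "(norm (th l (X \<omega>) - \<mu>))\<^sup>2 \<le> (norm (X \<omega>) + v)\<^sup>2"
        using norm_triangle_ineq4[of "th l (X \<omega>)" \<mu>] norm_th[OF l, of "X \<omega>"] norm_mean_le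
        by (intro power_mono) auto
      also have "(norm (X \<omega>) + v)\<^sup>2 \<le> 2 * ((norm (X \<omega>))\<^sup>2 + v\<^sup>2)"
        using sum_squares_bound[of "norm (X \<omega>)" v] by (simp add: power2_sum)
      finally have "(norm (d \<omega>))\<^sup>2 \<le> l\<^sup>2 * (2 * ((norm (X \<omega>))\<^sup>2 + v\<^sup>2))"
        by (simp add: mult_left_mono)
      hence "C / 2 * (norm (d \<omega>))\<^sup>2 \<le> C / 2 * (l\<^sup>2 * (2 * ((norm (X \<omega>))\<^sup>2 + v\<^sup>2)))"
        using C by (intro mult_left_mono) auto
      also have "\<dots> = C * l\<^sup>2 * ((norm (X \<omega>))\<^sup>2 + v\<^sup>2)" by simp
      finally have "C / 2 * (norm (d \<omega>))\<^sup>2 \<le> C * l\<^sup>2 * ((norm (X \<omega>))\<^sup>2 + v\<^sup>2)" .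
      with gd exp_smooth_norm_diff_le[OF \<epsilon> d2, of "S \<omega>"] show ?thesis
        unfolding E_def g_def C_def by linarith
    qed
    have pw': "W \<omega> * E \<omega> \<le> (1 + C * l\<^sup>2 * v\<^sup>2) * W \<omega> + l * ?A \<omega> + (1 + C) * l\<^sup>2 * ?Q \<omega>" for \<omega>
      using mult_left_mono[OF pw W(2), of \<omega>] by (simp add: algebra_simps)
    have "(\<integral>\<omega>. W \<omega> * E \<omega> \<partial>M)
        \<le> (\<integral>\<omega>. (1 + C * l\<^sup>2 * v\<^sup>2) * W \<omega> + l * ?A \<omega> + (1 + C) * l\<^sup>2 * ?Q \<omega> \<partial>M)"
      using iW iA iQ by (intro integral_mono iWE pw') auto
    also have "\<dots> = (1 + C * l\<^sup>2 * v\<^sup>2) * (\<integral>\<omega>. W \<omega> \<partial>M) + l * (\<integral>\<omega>. ?A \<omega> \<partial>M)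
                    + (1 + C) * l\<^sup>2 * (\<integral>\<omega>. ?Q \<omega> \<partial>M)"
      using iW iA iQ by (simp del: inner_scaleR_left)
    also have "\<dots> \<le> (1 + C * l\<^sup>2 * v\<^sup>2) * (\<integral>\<omega>. W \<omega> \<partial>M) + (1 + C) * l\<^sup>2 * (v\<^sup>2 * (\<integral>\<omega>. W \<omega> \<partial>M))"
      unfolding A0 using C weighted_second_moment[OF W] by (simp add: mult_left_mono)
    \<comment> \<open>In \<open>2 * C + 1\<close> one \<open>C\<close> comes from the bound
      \<open>v\<close> on the mean, the other from the second moment of \<open>X\<close>, and the 1
      from the thresholding bias.\<close>
    also have "\<dots> = (1 + K) * (\<integral>\<omega>. W \<omega> \<partial>M)" by (simp add: K_def algebra_simps)
    also have "\<dots> \<le> exp K * (\<integral>\<omega>. W \<omega> \<partial>M)"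
      using W(2) by (intro mult_right_mono exp_ge_add_one_self Bochner_Integration.integral_nonneg) auto
    finally show ?thesis .
  qed
  thus ?thesis by (simp add: E_def d_def K_def C_def)
qed

end

section \<open>Ville's inequality\<close>

text \<open>\<open>A n\<close> is the event that level \<open>c\<close> has not been exceeded up to
  time \<open>n\<close>. Induction on \<open>n\<close> replaces optional stopping: paths leaving
  \<open>A n\<close> are charged \<open>c\<close>, no more than their value on leaving. The form of
  \<open>adapted\<close> places \<open>A n\<close> in \<open>F n\<close>, so \<open>super\<close>
  applies to it.\<close>

lemma (in prob_space) ville_inequality:
  fixes N :: "nat \<Rightarrow> 'a \<Rightarrow> real"
  assumes sub: "\<And>n. subalgebra M (F n)"
    and adapted: "\<And>k n. k \<le> n \<Longrightarrow> N k \<in> borel_measurable (F n)"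
    and int: "\<And>n. integrable M (N n)"
    and nonneg: "\<And>n \<omega>. 0 \<le> N n \<omega>"
    and init: "(\<integral>\<omega>. N 0 \<omega> \<partial>M) \<le> 1"
    and super: "\<And>n A. A \<in> sets (F n) \<Longrightarrow>
        (\<integral>\<omega>. indicator A \<omega> * N (Suc n) \<omega> \<partial>M) \<le> (\<integral>\<omega>. indicator A \<omega> * N n \<omega> \<partial>M)"
    and c: "c > 0"
  shows "prob {\<omega> \<in> space M. \<forall>n. N n \<omega> \<le> c} \<ge> 1 - 1 / c"
proof -
  define A where "A n = {\<omega> \<in> space M. \<forall>k\<in>{..n}. N k \<omega> \<le> c}" for n
  have N_meas [measurable]: "N n \<in> borel_measurable M" for n using int by blast
  have A_F: "A n \<in> sets (F n)" for n
  proof -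
    have sp: "space (F n) = space M" using sub unfolding subalgebra_def by blast
    have "{\<omega> \<in> space (F n). \<forall>k\<in>{..n}. N k \<omega> \<le> c} \<in> sets (F n)"
      using adapted by (intro sets.sets_Collect_finite_All) auto
    thus ?thesis by (simp add: A_def sp)
  qed
  have A_M [measurable]: "A n \<in> sets M" for n using A_F sub unfolding subalgebra_def by blast
  have A_Suc: "A (Suc n) \<subseteq> A n" for n by (auto simp: A_def)
  have iA: "integrable M (\<lambda>\<omega>. indicator A \<omega> * N n \<omega>)" if "A \<in> sets M" for A n
    using integrable_mult_indicator[OF that int] by simp
  have ic: "integrable M (\<lambda>\<omega>. c * indicator A \<omega>)" if "A \<in> sets M" for A
    using that by (intro integrable_mult_right integrable_real_indicator) (auto simp: less_top[symmetric])
  \<comment> \<open>The left side is a lower bound for the mean of the process stopped at its first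
    exceedance: stopped paths count \<open>c\<close>, the others their current value.\<close>
  have "c * (1 - prob (A n)) + (\<integral>\<omega>. indicator (A n) \<omega> * N n \<omega> \<partial>M) \<le> 1" for n
  proof (induction n)
    case 0
    have "c * indicator (space M - A 0) \<omega> + indicator (A 0) \<omega> * N 0 \<omega> \<le> N 0 \<omega>" if "\<omega> \<in> space M" for \<omega>
      using that by (auto simp: A_def indicator_def)
    hence "(\<integral>\<omega>. c * indicator (space M - A 0) \<omega> + indicator (A 0) \<omega> * N 0 \<omega> \<partial>M) \<le> (\<integral>\<omega>. N 0 \<omega> \<partial>M)"
      using int by (intro integral_mono Bochner_Integration.integrable_add iA ic) auto
    also have "(\<integral>\<omega>. c * indicator (space M - A 0) \<omega> + indicator (A 0) \<omega> * N 0 \<omega> \<partial>M)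
             = c * (1 - prob (A 0)) + (\<integral>\<omega>. indicator (A 0) \<omega> * N 0 \<omega> \<partial>M)"
      by (subst Bochner_Integration.integral_add[OF ic iA]) (auto simp: prob_compl)
    finally show ?case using init by simp
  next
    case (Suc n)
    \<comment> \<open>A path that is in \<open>A n\<close> but not in \<open>A (Suc n)\<close> has
      \<open>N (Suc n) \<omega> > c\<close>.\<close>
    have "c * indicator (A n - A (Suc n)) \<omega> + indicator (A (Suc n)) \<omega> * N (Suc n) \<omega>
            \<le> indicator (A n) \<omega> * N (Suc n) \<omega>" if "\<omega> \<in> space M" for \<omega>
      using that A_Suc[of n] nonneg[of "Suc n" \<omega>] by (auto simp: A_def indicator_def le_Suc_eq)
    hence "(\<integral>\<omega>. c * indicator (A n - A (Suc n)) \<omega> + indicator (A (Suc n)) \<omega> * N (Suc n) \<omega> \<partial>M)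
            \<le> (\<integral>\<omega>. indicator (A n) \<omega> * N (Suc n) \<omega> \<partial>M)"
      by (intro integral_mono Bochner_Integration.integrable_add iA ic) auto
    also have "(\<integral>\<omega>. c * indicator (A n - A (Suc n)) \<omega> + indicator (A (Suc n)) \<omega> * N (Suc n) \<omega> \<partial>M)
             = c * (prob (A n) - prob (A (Suc n))) + (\<integral>\<omega>. indicator (A (Suc n)) \<omega> * N (Suc n) \<omega> \<partial>M)"
      by (subst Bochner_Integration.integral_add[OF ic iA]) (auto simp: finite_measure_Diff[OF A_M A_M A_Suc])
    also have "(\<integral>\<omega>. indicator (A n) \<omega> * N (Suc n) \<omega> \<partial>M) \<le> (\<integral>\<omega>. indicator (A n) \<omega> * N n \<omega> \<partial>M)"
      by (rule super[OF A_F])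
    finally show ?case using Suc by (simp add: algebra_simps)
  qed
  moreover have "(\<integral>\<omega>. indicator (A n) \<omega> * N n \<omega> \<partial>M) \<ge> 0" for n
    using nonneg by (intro Bochner_Integration.integral_nonneg) auto
  ultimately have "c * (1 - prob (A n)) \<le> 1" for n by (smt (verit))
  hence lower: "1 - 1 / c \<le> prob (A n)" for n using c by (simp add: field_simps)
  \<comment> \<open>The bound is uniform in \<open>n\<close>, so continuity from above along the
    decreasing events \<open>A n\<close> yields all times at once.\<close>
  have "(\<lambda>n. prob (A n)) \<longlonglongrightarrow> prob (\<Inter>n. A n)"
    using A_Suc by (intro finite_Lim_measure_decseq) (auto intro: decseq_SucI)
  moreover have "(\<Inter>n. A n) = {\<omega> \<in> space M. \<forall>n. N n \<omega> \<le> c}" by (auto simp: A_def)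
  ultimately show ?thesis using lower LIMSEQ_le_const by metis
qed

section \<open>The natural filtration\<close>

lemma sets_nat_filtration:
  "sets (nat_filtration M X t) = sigma_sets (space M) (\<Union>i\<in>{1..t}. {X i -` B \<inter> space M | B. B \<in> sets borel})"
  unfolding nat_filtration_def by (rule sets_measure_of) auto

lemma space_nat_filtration: "space (nat_filtration M X t) = space M"
  unfolding nat_filtration_def by (rule space_measure_of) auto

lemma subalgebra_nat_filtration:
  assumes "\<And>t. t \<ge> 1 \<Longrightarrow> X t \<in> borel_measurable M"
  shows "subalgebra M (nat_filtration M X t)"
  unfolding subalgebra_def space_nat_filtration sets_nat_filtration
  using assms by (auto intro!: sets.sigma_sets_subset measurable_sets)

lemma measurable_nat_filtration:
  fixes X :: "nat \<Rightarrow> 'w \<Rightarrow> 'a::topological_space"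
  assumes "i \<in> {1..t}"
  shows "X i \<in> borel_measurable (nat_filtration M X t)"
proof (rule measurableI)
  fix B :: "'a set" assume "B \<in> sets borel"
  thus "X i -` B \<inter> space (nat_filtration M X t) \<in> sets (nat_filtration M X t)"
    unfolding space_nat_filtration sets_nat_filtration
    by (intro sigma_sets.Basic UN_I[OF assms]) blast
qed auto

section \<open>The exponential supermartingale of the thresholded sums and its confidence
  sequence\<close>

theorem theorem3p7:
  fixes M :: "'w measure"
    and X :: "nat \<Rightarrow> 'w \<Rightarrow> 'a::euclidean_space"
    and \<mu> :: 'a
    and v \<beta> \<alpha> :: real
    and lam :: "nat \<Rightarrow> real"
  assumes "prob_space M"
    and "v > 0"
    and "\<And>t. t \<ge> 1 \<Longrightarrow> X t \<in> borel_measurable M"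
    and "\<And>t. t \<ge> 1 \<Longrightarrow> AE \<omega> in M. vec_cond_exp M (nat_filtration M X (t - 1)) (X t) \<omega> = \<mu>"
    and "\<And>t. t \<ge> 1 \<Longrightarrow> AE \<omega> in M.
           nn_cond_exp M (nat_filtration M X (t - 1)) (\<lambda>\<omega>. ennreal ((norm (X t \<omega>))\<^sup>2)) \<omega> \<le> ennreal (v\<^sup>2)"
    and "\<And>t. t \<ge> 1 \<Longrightarrow> lam t > 0"
    and "\<beta> > 0"
    and "0 < \<alpha>" and "\<alpha> < 1"
  shows "measure M {\<omega> \<in> space M. \<forall>t\<ge>1.
           norm ((\<Sum>i=1..t. lam i *\<^sub>R th (lam i) (X i \<omega>)) /\<^sub>R (\<Sum>i=1..t. lam i) - \<mu>)
           \<le> (v\<^sup>2 * (2 * exp (2 / \<beta> + 2) + 1) * (\<Sum>i=1..t. (lam i)\<^sup>2) + \<beta> / 2 + ln (1 / \<alpha>))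
             / (\<Sum>i=1..t. lam i)}
         \<ge> 1 - \<alpha>"
proof -
  interpret prob_space M by fact
  define F where "F n = nat_filtration M X n" for n
  \<comment> \<open>With this choice the gap \<open>\<epsilon>\<close> between norm and surrogate is
    the summand \<open>\<beta> / 2\<close> of the bound, and \<open>1 / \<epsilon>\<close> is the
    exponent \<open>2 / \<beta>\<close>.\<close>
  define \<epsilon> where "\<epsilon> = \<beta> / 2"
  have \<epsilon>: "\<epsilon> > 0" using \<open>\<beta> > 0\<close> by (simp add: \<epsilon>_def)
  define S where "S n \<omega> = (\<Sum>i=1..n. lam i *\<^sub>R (th (lam i) (X i \<omega>) - \<mu>))" for n \<omega>
  define K where "K = v\<^sup>2 * (2 * exp (2 / \<beta> + 2) + 1)"
  define L where "L n = (\<Sum>i=1..n. (lam i)\<^sup>2)" for n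
  define N where "N n \<omega> = exp (smooth_norm \<epsilon> (S n \<omega>) - K * L n)" for n \<omega>
  have K0: "K \<ge> 0" by (simp add: K_def)
  have L0: "L n \<ge> 0" for n by (simp add: L_def sum_nonneg)
  have sub: "subalgebra M (F n)" for n
    unfolding F_def by (rule subalgebra_nat_filtration) (rule assms(3))
  have S_F: "S k \<in> borel_measurable (F n)" if "k \<le> n" for k n
  proof -
    have X_F: "X i \<in> borel_measurable (F n)" if "i \<in> {1..k}" for i
      unfolding F_def using that \<open>k \<le> n\<close> by (intro measurable_nat_filtration) auto
    show ?thesis unfolding S_def[abs_def]
      by (intro borel_measurable_sum borel_measurable_scaleR borel_measurable_diff borel_measurable_const
          measurable_compose[OF X_F borel_measurable_th])
  qed
  have S_M [measurable]: "S n \<in> borel_measurable M" for n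
    using measurable_from_subalg[OF sub S_F[OF order_refl]] .
  have N_F: "N k \<in> borel_measurable (F n)" if "k \<le> n" for k n
  proof -
    note [measurable] = S_F[OF that]
    show ?thesis unfolding N_def[abs_def] by measurable
  qed
  have N_M [measurable]: "N n \<in> borel_measurable M" for n
    using measurable_from_subalg[OF sub N_F[OF order_refl]] .
  \<comment> \<open>A deterministic bound at each fixed time gives integrability of
    \<open>N n\<close> and the bounded weight required by the one-step estimate. A thresholded term
    scaled by \<open>lam i\<close> has norm at most 1, and the nonnegative compensator is
    dropped.\<close>
  have N_bound: "N n \<omega> \<le> exp (\<Sum>i=1..n. 1 + lam i * norm \<mu>)" for n \<omega>
  proof -
    have "smooth_norm \<epsilon> (S n \<omega>) \<le> norm (S n \<omega>)" by (rule smooth_norm_le_norm[OF \<epsilon>])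
    also have "\<dots> \<le> (\<Sum>i=1..n. 1 + lam i * norm \<mu>)"
      unfolding S_def
    proof (rule sum_norm_le)
      fix i assume "i \<in> {1..n}"
      hence l: "lam i > 0" using assms(6) by simp
      hence "norm (lam i *\<^sub>R (th (lam i) (X i \<omega>) - \<mu>)) = lam i * norm (th (lam i) (X i \<omega>) - \<mu>)" by simp
      also have "\<dots> \<le> lam i * (1 / lam i + norm \<mu>)"
        using norm_triangle_ineq4[of "th (lam i) (X i \<omega>)" \<mu>] norm_th[OF l, of "X i \<omega>"] l
        by (intro mult_left_mono) auto
      also have "\<dots> = 1 + lam i * norm \<mu>" using l by (simp add: field_simps)
      finally show "norm (lam i *\<^sub>R (th (lam i) (X i \<omega>) - \<mu>)) \<le> 1 + lam i * norm \<mu>" .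
    qed
    finally show ?thesis unfolding N_def using mult_nonneg_nonneg[OF K0 L0[of n]] by simp
  qed
  have N_pos: "N n \<omega> \<ge> 0" for n \<omega> by (simp add: N_def)
  have N_int: "integrable M (N n)" for n
    using N_bound N_pos by (intro integrable_const_bound[of _ "exp (\<Sum>i=1..n. 1 + lam i * norm \<mu>)"]) auto
  have super: "(\<integral>\<omega>. indicator A \<omega> * N (Suc n) \<omega> \<partial>M) \<le> (\<integral>\<omega>. indicator A \<omega> * N n \<omega> \<partial>M)"
    if A: "A \<in> sets (F n)" for n A
  proof -
    \<comment> \<open>The hypotheses are used at time \<open>Suc n\<close>, whose past
      \<open>Suc n - 1\<close> is \<open>n\<close>; for \<open>n = 0\<close> the past is
      trivial.\<close>
    interpret conditional_moments M "F n" "X (Suc n)" \<mu> v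
      using assms(2) assms(3)[of "Suc n"] assms(4)[of "Suc n"] assms(5)[of "Suc n"] sub
      by unfold_locales (auto simp: F_def)
    define W where "W \<omega> = indicator A \<omega> * N n \<omega>" for \<omega>
    note [measurable] = A N_F[OF order_refl, of n]
    have l: "lam (Suc n) > 0" using assms(6) by simp
    have W_F: "W \<in> borel_measurable (F n)" unfolding W_def[abs_def] by measurable
    have eps: "1 / \<epsilon> = 2 / \<beta>" by (simp add: \<epsilon>_def)
    let ?E = "\<lambda>\<omega>. exp (smooth_norm \<epsilon> (S n \<omega> + lam (Suc n) *\<^sub>R (th (lam (Suc n)) (X (Suc n) \<omega>) - \<mu>))
                       - smooth_norm \<epsilon> (S n \<omega>))"
    \<comment> \<open>One step multiplies \<open>N n\<close> by the exponential increment
      \<open>?E\<close> and by \<open>exp (- (K * (lam (Suc n))\<^sup>2))\<close>; the latter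
      cancels exactly the factor from the one-step estimate.\<close>
    have "indicator A \<omega> * N (Suc n) \<omega> = exp (- (K * (lam (Suc n))\<^sup>2)) * (W \<omega> * ?E \<omega>)" for \<omega>
      by (simp add: W_def N_def S_def L_def exp_add[symmetric] algebra_simps)
    hence "(\<integral>\<omega>. indicator A \<omega> * N (Suc n) \<omega> \<partial>M) = exp (- (K * (lam (Suc n))\<^sup>2)) * (\<integral>\<omega>. W \<omega> * ?E \<omega> \<partial>M)"
      by simp
    also have "\<dots> \<le> exp (- (K * (lam (Suc n))\<^sup>2)) * (exp (K * (lam (Suc n))\<^sup>2) * (\<integral>\<omega>. W \<omega> \<partial>M))"
      unfolding K_def eps[symmetric]
    proof (intro mult_left_mono weighted_exp_smooth_norm_step W_F S_F order_refl l \<epsilon>)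
      show "0 \<le> W \<omega>" "W \<omega> \<le> exp (\<Sum>i=1..n. 1 + lam i * norm \<mu>)" for \<omega>
        using N_pos[of n \<omega>] N_bound[of n \<omega>] by (auto simp: W_def indicator_def)
    qed auto
    also have "\<dots> = (\<integral>\<omega>. W \<omega> \<partial>M)" by (simp add: exp_minus)
    finally show ?thesis unfolding W_def .
  qed
  let ?good = "{\<omega> \<in> space M. \<forall>n. N n \<omega> \<le> 1 / \<alpha>}"
  have "1 - \<alpha> \<le> prob ?good"
    \<comment> \<open>Level \<open>1 / \<alpha>\<close> gives failure probability
      \<open>\<alpha>\<close>. The remaining initial condition holds because the empty sums make
      \<open>N 0\<close> equal to 1.\<close>
    using ville_inequality[of F N "1 / \<alpha>", OF sub N_F N_int N_pos _ super] \<open>0 < \<alpha>\<close>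
    by (simp add: N_def S_def L_def smooth_norm_zero[OF \<epsilon>] prob_space)
  also have "\<dots> \<le> prob {\<omega> \<in> space M. \<forall>t\<ge>1.
           norm ((\<Sum>i=1..t. lam i *\<^sub>R th (lam i) (X i \<omega>)) /\<^sub>R (\<Sum>i=1..t. lam i) - \<mu>)
           \<le> (K * (\<Sum>i=1..t. (lam i)\<^sup>2) + \<beta> / 2 + ln (1 / \<alpha>)) / (\<Sum>i=1..t. lam i)}"
    (is "_ \<le> prob ?goal")
  proof -
    define \<Lambda> where "\<Lambda> t = (\<Sum>i=1..t. lam i)" for t
    have \<Lambda>: "\<Lambda> t > 0" if "t \<ge> 1" for t
      unfolding \<Lambda>_def using that assms(6) by (intro sum_pos) auto
    have dev: "norm ((\<Sum>i=1..t. lam i *\<^sub>R th (lam i) (X i \<omega>)) /\<^sub>R \<Lambda> t - \<mu>) = norm (S t \<omega>) / \<Lambda> t"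
      if "t \<ge> 1" for t \<omega>
    proof -
      \<comment> \<open>Undoing the centring of each increment costs the total weight times
        \<open>\<mu>\<close>, so the error of the weighted mean is \<open>S t \<omega>\<close>
        divided by \<open>\<Lambda> t\<close>.\<close>
      have "(\<Sum>i=1..t. lam i *\<^sub>R th (lam i) (X i \<omega>)) = S t \<omega> + \<Lambda> t *\<^sub>R \<mu>"
        by (simp add: S_def \<Lambda>_def scaleR_diff_right sum_subtractf scaleR_sum_left)
      hence "(\<Sum>i=1..t. lam i *\<^sub>R th (lam i) (X i \<omega>)) /\<^sub>R \<Lambda> t - \<mu> = S t \<omega> /\<^sub>R \<Lambda> t"
        using \<Lambda>[OF that] by (simp add: scaleR_add_right)
      thus ?thesis using \<Lambda>[OF that] by (simp add: divide_inverse mult.commute)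
    qed
    have eq: "?goal = {\<omega> \<in> space M. \<forall>t\<ge>1. norm (S t \<omega>) / \<Lambda> t \<le> (K * L t + \<beta> / 2 + ln (1 / \<alpha>)) / \<Lambda> t}"
      using dev unfolding \<Lambda>_def L_def by auto
    show ?thesis
    proof (rule finite_measure_mono)
      show "?goal \<in> sets M" unfolding eq by measurable
      show "?good \<subseteq> ?goal" unfolding eq
      proof safe
        fix \<omega> and t :: nat
        assume "\<forall>n. N n \<omega> \<le> 1 / \<alpha>" and t: "t \<ge> 1"
        \<comment> \<open>Taking logarithms bounds
          \<open>smooth_norm \<epsilon> (S t \<omega>)\<close> by
          \<open>K * L t + ln (1 / \<alpha>)\<close>; passing to the norm adds
          \<open>\<epsilon> = \<beta> / 2\<close>.\<close>
        hence "ln (N t \<omega>) \<le> ln (1 / \<alpha>)" using \<open>0 < \<alpha>\<close> by (subst ln_le_cancel_iff) (auto simp: N_def)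
        hence "norm (S t \<omega>) \<le> K * L t + \<beta> / 2 + ln (1 / \<alpha>)"
          using norm_le_smooth_norm[of "S t \<omega>" \<epsilon>] by (simp add: N_def \<epsilon>_def)
        thus "norm (S t \<omega>) / \<Lambda> t \<le> (K * L t + \<beta> / 2 + ln (1 / \<alpha>)) / \<Lambda> t"
          using \<Lambda>[OF t] by (intro divide_right_mono) auto
      qed
    qed
  qed
  finally show ?thesis unfolding K_def .
qed

end
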